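(* Let $D$ be a (finite, loopless) digraph and let $G$ be its underlying undirected graph. Let $\mathbf{X}_D \in \mathsf{NSym}$ be the chromatic noncommutative symmetric function of $D$, let $X_G \in \mathsf{Sym}$ be Stanley's chromatic symmetric function of $G$, and let $\chi\colon \mathsf{NSym} \to \mathsf{Sym}$ be the forgetful (commutative image) morphism. Then $$\chi(\mathbf{X}_D) = X_G.$$
   Context: Fix a field $\mathbb{k}$ of characteristic $0$. **Sym.** $\mathsf{Sym}$ is the $\mathbb{k}$-algebra of symmetric functions in commuting variables $x_1, x_2, \ldots$, i.e. $\mathsf{Sym} = \mathbb{k}[h_1,h_2,\ldots]$ where $h_n = \sum_{i_1 \le \cdots \le i_n} x_{i_1}\cdots x_{i_n}$ is the complete homogeneous symmetric function and $h_0=1$. For a partition $\lambda$, $h_\lambda = h_{\lambda_1} h_{\lambda_2}\cdots h_{\lambda_{\ell(\lambda)}}$. **NSym.** $\mathsf{NSym} = \mathbb{k}\langle H_1,H_2,\ldots\rangle$ is the free associative unital $\mathbb{k}$-algebra on noncommuting generators $H_n$ with $\deg H_n = n$. A composition is a finite tuple $\alpha = (\alpha_1,\ldots,\alpha_{\ell(\alpha)})$ of positive integers; $H_\alpha = H_{\alpha_1}\cdots H_{\alpha_{\ell(\alpha)}}$, $H_{()}=1$. For compositions $\alpha,\beta$ of the same integer, write $\beta \ge \alpha$ if $D(\beta) \subseteq D(\alpha)$, where $D(c) = \{c_1, c_1+c_2, \ldots, c_1+\cdots+c_{\ell(c)-1}\}$. The ribbon elements are $R_\alpha = \sum_{\beta\ge\alpha}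 (-1)^{\ell(\alpha)-\ell(\beta)} H_\beta$. Define $\Psi_n = \sum_{i=0}^{n-1} (-1)^i R_{(1^i,\,n-i)}$ for $n \ge 1$, where $(1^i, n-i)$ is the composition consisting of $i$ ones followed by $n-i$, and $\Psi_\alpha = \Psi_{\alpha_1}\Psi_{\alpha_2}\cdots\Psi_{\alpha_{\ell(\alpha)}}$, $\Psi_{()}=1$. **Forgetful morphism.** $\chi\colon \mathsf{NSym}\to\mathsf{Sym}$ is the linear map (an algebra morphism) with $\chi(H_\alpha) = h_{\mathrm{sort}(\alpha)}$, where $\mathrm{sort}(\alpha)$ is the partition obtained by sorting the entries of $\alpha$ into weakly decreasing order. **Chromatic symmetric function.** For a finite simple graph $G$, $X_G = \sum_{\kappa} \prod_{v\in V(G)} x_{\kappa(v)}$, summed over all proper colorings $\kappa\colon V(G)\to\{1,2,\ldots\}$ (adjacent vertices receive different colors). **Digraphs.** A digraph $D=(V(D),E(D))$ consists of a finite set $V(D)$ and a set $E(D)$ of ordered pairs (arcs) of elements of $V(D)$, with no loops. Its underlying undirected graph $G$ has vertex set $V(D)$ and edge set $\{\{u,v\} : (u,v)\in E(D)\}$. For a vertex $w$, the outdegree $\mathrm{od}\,w$ is the number of $v$ with $(w,v)\in E(D)$, and the indegree $\mathrm{id}\,w$ is the number of $v$ with $(v,w)\in E(D)$. For $W\subseteq V(D)$, the total degree (computed in all of $D$) is $\mathrm{td}\,W = \sum_{w\in W}\mathrm{od}\,w - \sum_{w\in W}\mathrm{id}\,w$. **The composition $\alpha(S)$.** Let $S\subseteq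 E(D)$ and $S' = \{\{u,v\} : (u,v)\in S\}\subseteq E(G)$. Consider the vertex sets of the connected components of the spanning subgraph $(V(D),S')$ of $G$. Fix a labeling (total order) $v_1<v_2<\cdots<v_{|V|}$ of $V = V(D)$. For two distinct components $C,C'$ put $C\rhd C'$ if: (1) $\mathrm{td}\,C>\mathrm{td}\,C'$; or (2) $\mathrm{td}\,C=\mathrm{td}\,C'$ and $|C|>|C'|$; or (3) $\mathrm{td}\,C=\mathrm{td}\,C'$, $|C|=|C'|$, and $C$ is lexicographically strictly greater than $C'$, where a vertex subset is identified with the word of its vertex indices written in increasing order. Then $\alpha(S)$ is the composition of $|V|$ listing the sizes of the components in the order given by $\rhd$, with $\rhd$-greatest component first (so components of larger total degree come first). The composition $\alpha(S)$ does not depend on the chosen labeling. **Chromatic noncommutative symmetric function.** $$\mathbf{X}_D = \sum_{S\subseteq E(D)} (-1)^{|S|}\,\Psi_{\alpha(S)} \in \mathsf{NSym}.$$ *)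

theory Defs
  imports
    "HOL-Library.Poly_Mapping"
    "HOL-Library.Multiset"
    "HOL-Library.FuncSet"
    "Graph_Theory.Pair_Digraph"
begin

text \<open>
  A monomial is the multiset of the indices of its variables, so a product of
  monomials is a sum of multisets.  Only the variables with index \<open>1, 2, \<dots>\<close> are
  used below; \<open>var 0\<close> never occurs.
\<close>

typedef 'k mseries = "UNIV :: (nat multiset \<Rightarrow> 'k) set"
  morphisms mcoeff MSeries ..

setup_lifting type_definition_mseries

lemma mseries_eqI: "(\<And>M. mcoeff f M = mcoeff g M) \<Longrightarrow> f = g"
  by transfer auto

definition splits :: "nat multiset \<Rightarrow> (nat multiset \<times> nat multiset) set" where
  "splits M = {(A, B). A + B = M}"

lemma finite_splits: "finite (splits M)"
proof (induction M)
  case empty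
  have "splits {#} = {({#}, {#})}" by (auto simp: splits_def)
  then show ?case by simp
next
  case (add x M)
  have "splits (add_mset x M) \<subseteq>
      (\<lambda>(A, B). (add_mset x A, B)) ` splits M \<union> (\<lambda>(A, B). (A, add_mset x B)) ` splits M"
  proof
    fix p assume "p \<in> splits (add_mset x M)"
    then obtain A B where p: "p = (A, B)" and AB: "A + B = add_mset x M"
      by (auto simp: splits_def)
    then have "x \<in># A \<or> x \<in># B" by (metis union_iff union_single_eq_member)
    then show "p \<in> (\<lambda>(A, B). (add_mset x A, B)) ` splits M
        \<union> (\<lambda>(A, B). (A, add_mset x B)) ` splits M"
    proof
      assume "x \<in># A"
      then obtain A' where A': "A = add_mset x A'" by (metis mset_add)
      with AB have "(A', B) \<in> splits M" by (simp add: splits_def)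
      with p A' show ?thesis by force
    next
      assume "x \<in># B"
      then obtain B' where B': "B = add_mset x B'" by (metis mset_add)
      with AB have "(A, B') \<in> splits M" by (simp add: splits_def)
      with p B' show ?thesis by force
    qed
  qed
  with add show ?case by (meson finite_UnI finite_imageI finite_subset)
qed

instantiation mseries :: (comm_ring_1) comm_ring_1
begin

lift_definition zero_mseries :: "'a mseries" is "\<lambda>_. 0" .
lift_definition one_mseries :: "'a mseries" is "\<lambda>M. if M = {#} then 1 else 0" .
lift_definition plus_mseries :: "'a mseries \<Rightarrow> 'a mseries \<Rightarrow> 'a mseries"
  is "\<lambda>f g M. f M + g M" .
lift_definition minus_mseries :: "'a mseries \<Rightarrow> 'a mseries \<Rightarrow> 'a mseries"
  is "\<lambda>f g M. f M - g M" .
lift_definition uminus_mseries :: "'a mseries \<Rightarrow> 'a mseries"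
  is "\<lambda>f M. - f M" .
lift_definition times_mseries :: "'a mseries \<Rightarrow> 'a mseries \<Rightarrow> 'a mseries"
  is "\<lambda>f g M. \<Sum>(A, B) \<in> splits M. f A * g B" .

instance
proof
  fix a b c :: "'a mseries"
  show "a * b * c = a * (b * c)"
  proof (rule mseries_eqI)
    fix M
    have "mcoeff (a * b * c) M =
        (\<Sum>(A, C)\<in>splits M. \<Sum>(P, Q)\<in>splits A. mcoeff a P * mcoeff b Q * mcoeff c C)"
      by (auto simp: times_mseries.rep_eq sum_distrib_right intro!: sum.cong)
    also have "\<dots> = (\<Sum>((A, C), P, Q)\<in>Sigma (splits M) (\<lambda>(A, C). splits A).
        mcoeff a P * mcoeff b Q * mcoeff c C)"
      by (subst sum.Sigma[symmetric]) (auto simp: finite_splits intro!: sum.cong)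
    also have "\<dots> = (\<Sum>((A, C), P, Q)\<in>Sigma (splits M) (\<lambda>(A, C). splits C).
        mcoeff a A * (mcoeff b P * mcoeff c Q))"
      by (rule sum.reindex_bij_witness[where
            i = "\<lambda>((A, C), P, Q). ((A + P, Q), A, P)" and
            j = "\<lambda>((A, C), P, Q). ((P, Q + C), Q, C)"])
         (auto simp: splits_def algebra_simps)
    also have "\<dots> =
        (\<Sum>(A, C)\<in>splits M. \<Sum>(P, Q)\<in>splits C. mcoeff a A * (mcoeff b P * mcoeff c Q))"
      by (subst sum.Sigma[symmetric]) (auto simp: finite_splits intro!: sum.cong)
    also have "\<dots> = mcoeff (a * (b * c)) M"
      by (auto simp: times_mseries.rep_eq sum_distrib_left intro!: sum.cong)
    finally show "mcoeff (a * b * c) M = mcoeff (a * (b * c)) M" .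
  qed
  show "a * b = b * a"
  proof (rule mseries_eqI)
    fix M
    show "mcoeff (a * b) M = mcoeff (b * a) M"
      unfolding times_mseries.rep_eq
      by (rule sum.reindex_bij_witness[where i = prod.swap and j = prod.swap])
         (auto simp: splits_def ac_simps)
  qed
  show "1 * a = a"
  proof (rule mseries_eqI)
    fix M
    have "mcoeff (1 * a) M = (\<Sum>(A, B)\<in>{({#}, M)}. mcoeff 1 A * mcoeff a B)"
      unfolding times_mseries.rep_eq
      by (rule sum.mono_neutral_right)
         (auto simp: finite_splits[unfolded splits_def] splits_def one_mseries.rep_eq
           split: if_splits)
    then show "mcoeff (1 * a) M = mcoeff a M" by (simp add: one_mseries.rep_eq)
  qed
  show "(a + b) * c = a * c + b * c"
    by (rule mseries_eqI)
       (auto simp: times_mseries.rep_eq plus_mseries.rep_eq sum.distrib[symmetric]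
         algebra_simps intro!: sum.cong)
  show "(0 :: 'a mseries) \<noteq> 1"
    by transfer (auto simp: fun_eq_iff)
qed (transfer; simp add: fun_eq_iff algebra_simps)+

end

lift_definition mscale :: "'k::comm_ring_1 \<Rightarrow> 'k mseries \<Rightarrow> 'k mseries"
  is "\<lambda>c f M. c * f M" .

lift_definition var :: "nat \<Rightarrow> 'k::comm_ring_1 mseries"
  is "\<lambda>i M. if M = {#i#} then 1 else 0" .

text \<open>
  Sum of a possibly infinite family in which every monomial occurs in only finitely
  many members; this holds for both families to which it is applied.
\<close>

definition formal_sum :: "('b \<Rightarrow> 'k::comm_ring_1 mseries) \<Rightarrow> 'b set \<Rightarrow> 'k mseries" where
  "formal_sum f I = MSeries (\<lambda>M. \<Sum>i | i \<in> I \<and> mcoeff (f i) M \<noteq> 0. mcoeff (f i) M)"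

definition h :: "nat \<Rightarrow> 'k::comm_ring_1 mseries" where
  "h n = formal_sum (\<lambda>is. \<Prod>i\<leftarrow>is. var i)
     {is. length is = n \<and> sorted is \<and> set is \<subseteq> {1..}}"

definition h_part :: "nat list \<Rightarrow> 'k::comm_ring_1 mseries" where
  "h_part p = (\<Prod>n\<leftarrow>p. h n)"

inductive_set Sym :: "'k::comm_ring_1 mseries set" where
  Sym_one: "1 \<in> Sym"
| Sym_h: "h n \<in> Sym"
| Sym_scale: "f \<in> Sym \<Longrightarrow> mscale c f \<in> Sym"
| Sym_add: "f \<in> Sym \<Longrightarrow> g \<in> Sym \<Longrightarrow> f + g \<in> Sym"
| Sym_mult: "f \<in> Sym \<Longrightarrow> g \<in> Sym \<Longrightarrow> f * g \<in> Sym"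

typedef composition = "{c :: nat list. 0 \<notin> set c}"
  morphisms parts Composition
  by (rule exI[of _ "[]"]) simp

setup_lifting type_definition_composition

instantiation composition :: monoid_add
begin

lift_definition zero_composition :: composition is "[]" by simp
lift_definition plus_composition :: "composition \<Rightarrow> composition \<Rightarrow> composition"
  is "(@)" by simp

instance by standard (transfer; simp)+

end

text \<open>
  Compositions under concatenation are the free monoid on the positive integers, so
  the convolution ring of finitely supported functions on them is the free
  associative algebra.
\<close>

type_synonym 'k nsym = "composition \<Rightarrow>\<^sub>0 'k"

definition H :: "nat \<Rightarrow> 'k::field_char_0 nsym" where
  "H n = Poly_Mapping.single (Composition [n]) 1"

definition H_comp :: "composition \<Rightarrow> 'k::field_char_0 nsym" where
  "H_comp a = (\<Prod>n\<leftarrow>parts a. H n)"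

lemma H_comp_eq_single: "H_comp a = Poly_Mapping.single a 1"
proof -
  have "0 \<notin> set c \<Longrightarrow> (\<Prod>n\<leftarrow>c. H n :: 'a nsym) = Poly_Mapping.single (Composition c) 1" for c
  proof (induction c)
    case Nil
    then show ?case by (simp add: zero_composition_def[symmetric])
  next
    case (Cons n c)
    have "Composition [n] + Composition c = Composition (n # c)"
      using Cons.prems by (simp add: plus_composition.abs_eq eq_onp_def)
    with Cons show ?case by (simp add: H_def Poly_Mapping.mult_single)
  qed
  from this[of "parts a"] show ?thesis
    using parts[of a] by (simp add: H_comp_def parts_inverse)
qed

definition descents :: "composition \<Rightarrow> nat set" where
  "descents c = {sum_list (take k (parts c)) | k. 0 < k \<and> k < length (parts c)}"

definition coarser :: "composition \<Rightarrow> composition \<Rightarrow> bool" where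
  "coarser b a \<longleftrightarrow> sum_list (parts b) = sum_list (parts a) \<and> descents b \<subseteq> descents a"

text \<open>A coarser composition has no more parts, so the subtraction does not truncate.\<close>

definition ribbon :: "composition \<Rightarrow> 'k::field_char_0 nsym" where
  "ribbon a = (\<Sum>b | coarser b a. (-1) ^ (length (parts a) - length (parts b)) * H_comp b)"

definition Psi :: "nat \<Rightarrow> 'k::field_char_0 nsym" where
  "Psi n = (\<Sum>i<n. (-1) ^ i * ribbon (Composition (replicate i 1 @ [n - i])))"

definition Psi_comp :: "composition \<Rightarrow> 'k::field_char_0 nsym" where
  "Psi_comp a = (\<Prod>n\<leftarrow>parts a. Psi n)"

definition chi :: "'k::field_char_0 nsym \<Rightarrow> 'k mseries" where
  "chi x = (\<Sum>a\<in>Poly_Mapping.keys x.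
     mscale (Poly_Mapping.lookup x a) (h_part (rev (sort (parts a)))))"

lemma chi_H_comp: "chi (H_comp a) = h_part (rev (sort (parts a)))"
proof -
  have "mscale 1 f = f" for f :: "'a mseries" by transfer simp
  then show ?thesis by (simp add: chi_def H_comp_eq_single)
qed

lemma chi_in_Sym: "chi x \<in> Sym"
proof -
  have "h_part p \<in> Sym" for p :: "nat list"
    by (induction p) (auto simp: h_part_def intro: Sym.intros)
  moreover have "(0 :: 'a mseries) = mscale 0 1" by transfer auto
  then have "(0 :: 'a mseries) \<in> Sym" by (metis Sym_one Sym_scale)
  then have "(\<And>a. a \<in> A \<Longrightarrow> f a \<in> Sym) \<Longrightarrow> sum f A \<in> Sym"
    for f :: "composition \<Rightarrow> 'a mseries" and A
    by (induction A rule: infinite_finite_induct) (auto intro: Sym_add)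
  ultimately show ?thesis unfolding chi_def by (metis (no_types, lifting) Sym_scale)
qed

definition undirected :: "('a \<times> 'a) set \<Rightarrow> 'a set set" where
  "undirected S = {{u, v} | u v. (u, v) \<in> S}"

definition components :: "'a set \<Rightarrow> 'a set set \<Rightarrow> 'a set set" where
  "components V F = V // {(u, v). u \<in> V \<and> v \<in> V \<and> (u, v) \<in> {(a, b). {a, b} \<in> F}\<^sup>*}"

definition proper_colorings :: "'a set \<Rightarrow> 'a set set \<Rightarrow> ('a \<Rightarrow> nat) set" where
  "proper_colorings V F = {\<kappa> \<in> V \<rightarrow>\<^sub>E {1..}. \<forall>u v. {u, v} \<in> F \<longrightarrow> \<kappa> u \<noteq> \<kappa> v}"

definition chromatic_sym :: "'a set \<Rightarrow> 'a set set \<Rightarrow> 'k::comm_ring_1 mseries" where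
  "chromatic_sym V F = formal_sum (\<lambda>\<kappa>. \<Prod>v\<in>V. var (\<kappa> v)) (proper_colorings V F)"

definition total_degree :: "'a pair_pre_digraph \<Rightarrow> 'a set \<Rightarrow> int" where
  "total_degree D W = (\<Sum>w\<in>W. int (out_degree (with_proj D) w))
     - (\<Sum>w\<in>W. int (in_degree (with_proj D) w))"

text \<open>
  The argument \<open>lab\<close> is meant to be a bijection from the vertex set onto
  \<open>{1..card (pverts D)}\<close>.  On the components of a spanning subgraph,
  \<open>comp_greater lab D\<close> is then a strict linear order, so the list described in
  \<open>sorted_components\<close> exists and is unique; its members are nonempty, so
  \<open>Composition\<close> is applied in \<open>alpha\<close> to a list of positive numbers.
\<close>

definition index_word :: "('a \<Rightarrow> nat) \<Rightarrow> 'a set \<Rightarrow> nat list" where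
  "index_word lab C = sorted_list_of_set (lab ` C)"

definition comp_greater ::
  "('a \<Rightarrow> nat) \<Rightarrow> 'a pair_pre_digraph \<Rightarrow> 'a set \<Rightarrow> 'a set \<Rightarrow> bool" where
  "comp_greater lab D C C' \<longleftrightarrow>
     total_degree D C > total_degree D C'
   \<or> total_degree D C = total_degree D C' \<and> card C > card C'
   \<or> total_degree D C = total_degree D C' \<and> card C = card C'
       \<and> (index_word lab C', index_word lab C) \<in> lexord {(i, j). i < j}"

definition sorted_components ::
  "('a \<Rightarrow> nat) \<Rightarrow> 'a pair_pre_digraph \<Rightarrow> ('a \<times> 'a) set \<Rightarrow> 'a set list" where
  "sorted_components lab D S =
     (THE Cs. distinct Cs \<and> set Cs = components (pverts D) (undirected S)
        \<and> sorted_wrt (comp_greater lab D) Cs)"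

definition alpha ::
  "('a \<Rightarrow> nat) \<Rightarrow> 'a pair_pre_digraph \<Rightarrow> ('a \<times> 'a) set \<Rightarrow> composition" where
  "alpha lab D S = Composition (map card (sorted_components lab D S))"

definition chromatic_nsym ::
  "('a \<Rightarrow> nat) \<Rightarrow> 'a pair_pre_digraph \<Rightarrow> 'k::field_char_0 nsym" where
  "chromatic_nsym lab D = (\<Sum>S\<in>Pow (parcs D). (-1) ^ card S * Psi_comp (alpha lab D S))"

end

theory Submission
  imports Defs
begin

text \<open>
  Splitting off the first part shows that \<open>\<Sum>\<^sub>c (-1)\<^bsup>\<ell>(c)-1\<^esup> last(c) h\<^sub>c\<close>, summed over the
  compositions \<open>c\<close> of \<open>n\<close>, satisfies Newton's recursion for the power sum \<open>p\<^sub>n\<close>; this sum is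
  the commutative image of \<open>\<Psi>\<^sub>n\<close>.  Hence \<open>\<chi>(X\<^sub>D)\<close> is the sum over \<open>S\<close> of \<open>(-1)\<^bsup>|S|\<^esup>\<close> times the
  product of \<open>p\<^bsub>|C|\<^esub>\<close> over the components \<open>C\<close>, which is the sum over all colorings constant on the
  arcs in \<open>S\<close>, so the order of the components is irrelevant.  Exchanging the two sums gives each
  coloring the weight \<open>\<Prod>\<^sub>e (1 - [e is monochromatic])\<close> over the arcs \<open>e\<close>, which selects the proper
  ones; a pair of opposite arcs does no harm.  To keep all sums over colorings finite,
  coefficients are compared at one monomial at a time, using only its variables.
\<close>

section \<open>Monomials and truncation\<close>

definition monomial :: "nat multiset \<Rightarrow> 'k::comm_ring_1 mseries" where
  "monomial A = MSeries (\<lambda>M. if M = A then 1 else 0)"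

lemma mcoeff_monomial: "mcoeff (monomial A) M = (if M = A then 1 else 0)"
  by (simp add: monomial_def MSeries_inverse)

lemma mcoeff_monomial_mult:
  "mcoeff (monomial A * f) M = (if A \<subseteq># M then mcoeff f (M - A) else 0)"
proof -
  have "mcoeff (monomial A * f) M
      = (\<Sum>p\<in>splits M. case p of (P, Q) \<Rightarrow> mcoeff (monomial A) P * mcoeff f Q)"
    by (simp add: times_mseries.rep_eq)
  also have "\<dots> = (\<Sum>p\<in>splits M \<inter> {(A, M - A)}. mcoeff f (snd p))"
    by (rule sum.mono_neutral_cong_right)
       (auto simp: finite_splits, auto simp: splits_def mcoeff_monomial split: if_splits)
  also have "splits M \<inter> {(A, M - A)} = (if A \<subseteq># M then {(A, M - A)} else {})"
    by (auto simp: splits_def) (metis mset_subset_eq_add_left)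
  finally show ?thesis by simp
qed

lemma monomial_mult: "monomial A * monomial B = monomial (A + B)"
  by (rule mseries_eqI)
     (auto simp: mcoeff_monomial_mult mcoeff_monomial dest: subset_mset.add_diff_inverse)

lemma monomial_empty: "monomial {#} = 1"
  by (rule mseries_eqI) (simp add: mcoeff_monomial one_mseries.rep_eq)

lemma var_eq_monomial: "var i = monomial {#i#}"
  by (rule mseries_eqI) (simp add: mcoeff_monomial var.rep_eq)

lemma prod_list_var: "(\<Prod>i\<leftarrow>is. var i) = monomial (mset is)"
  by (induction "is") (simp_all add: monomial_empty var_eq_monomial monomial_mult)

lemma var_power: "var i ^ n = monomial (replicate_mset n i)"
  by (induction n) (simp_all add: monomial_empty var_eq_monomial monomial_mult)

lemma prod_var:
  assumes "finite V"
  shows "(\<Prod>v\<in>V. var (\<kappa> v)) = monomial (image_mset \<kappa> (mset_set V))"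
  using assms by (induction V) (simp_all add: monomial_empty var_eq_monomial monomial_mult)

section \<open>Extraction of coefficients\<close>

lemma mcoeff_0 [simp]: "mcoeff 0 M = 0"
  and mcoeff_add: "mcoeff (f + g) M = mcoeff f M + mcoeff g M"
  and mcoeff_uminus: "mcoeff (- f) M = - mcoeff f M"
  by (simp_all add: zero_mseries.rep_eq plus_mseries.rep_eq uminus_mseries.rep_eq)

lemma mcoeff_sum: "mcoeff (sum f I) M = (\<Sum>i\<in>I. mcoeff (f i) M)"
  by (induction I rule: infinite_finite_induct) (simp_all add: mcoeff_add)

lemma mcoeff_minus_one_power_mult:
  "mcoeff ((- 1) ^ n * f) M = (- 1) ^ n * mcoeff f M"
  by (induction n) (simp_all add: mcoeff_uminus)

lemma mcoeff_of_nat_mult: "mcoeff (of_nat n * f) M = of_nat n * mcoeff f M"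
  by (induction n) (simp_all add: mcoeff_add algebra_simps)

text \<open>Turns coefficients of formal sums into counts. If infinitely many indices give
  \<open>M\<close>, both sides are 0 by the conventions for \<open>sum\<close> and
  \<open>card\<close>.\<close>

lemma mcoeff_formal_sum_monomial:
  assumes "\<And>i. i \<in> I \<Longrightarrow> f i = monomial (m i)"
  shows "mcoeff (formal_sum f I) M = of_nat (card {i \<in> I. m i = M})"
proof -
  have "mcoeff (formal_sum f I) M = (\<Sum>i | i \<in> I \<and> mcoeff (f i) M \<noteq> 0. mcoeff (f i) M)"
    by (simp add: formal_sum_def MSeries_inverse)
  also have "\<dots> = (\<Sum>i\<in>{i \<in> I. m i = M}. 1)"
    by (rule sum.cong) (auto simp: assms mcoeff_monomial split: if_splits)
  finally show ?thesis by simp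
qed

text \<open>All divisors of \<open>M\<close> are included, since the coefficient of a product at
  \<open>M\<close> involves the factors at every divisor; this makes the relation compatible with
  products.\<close>

definition agree_upto :: "nat multiset \<Rightarrow> 'k::comm_ring_1 mseries \<Rightarrow> 'k mseries \<Rightarrow> bool" where
  "agree_upto M f g \<longleftrightarrow> (\<forall>A. A \<subseteq># M \<longrightarrow> mcoeff f A = mcoeff g A)"

lemma agree_upto_mult:
  assumes "agree_upto M f f'" "agree_upto M g g'"
  shows "agree_upto M (f * g) (f' * g')"
  unfolding agree_upto_def
proof (intro allI impI)
  fix A assume "A \<subseteq># M"
  have "mcoeff f P * mcoeff g Q = mcoeff f' P * mcoeff g' Q" if "(P, Q) \<in> splits A" for P Q
  proof -
    have "P \<subseteq># A" "Q \<subseteq># A" using that by (auto simp: splits_def)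
    then have "P \<subseteq># M" "Q \<subseteq># M" using \<open>A \<subseteq># M\<close> subset_mset.order_trans by blast+
    then show ?thesis using assms by (simp add: agree_upto_def)
  qed
  then show "mcoeff (f * g) A = mcoeff (f' * g') A"
    unfolding times_mseries.rep_eq by (intro sum.cong) auto
qed

lemma agree_upto_prod:
  assumes "\<And>i. i \<in> I \<Longrightarrow> agree_upto M (f i) (g i)"
  shows "agree_upto M (prod f I) (prod g I)"
  using assms
  by (induction I rule: infinite_finite_induct)
     (auto simp: agree_upto_mult, auto simp: agree_upto_def)

section \<open>Power sums and Newton's identity\<close>

text \<open>Junk at \<open>n = 0\<close>, where the family of summands is constantly \<open>1\<close>.\<close>

definition psum :: "nat \<Rightarrow> 'k::comm_ring_1 mseries" where
  "psum n = formal_sum (\<lambda>i. var i ^ n) {1..}"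

text \<open>A multiset has exactly one sorted listing, so at most one index word contributes to each
  coefficient.\<close>

lemma mcoeff_h: "mcoeff (h n :: 'k::comm_ring_1 mseries) M = of_bool (size M = n \<and> 0 \<notin># M)"
proof -
  have "mcoeff (h n :: 'k mseries) M
      = of_nat (card {is \<in> {is. length is = n \<and> sorted is \<and> set is \<subseteq> {1..}}. mset is = M})"
    unfolding h_def by (rule mcoeff_formal_sum_monomial) (rule prod_list_var)
  also have "{is \<in> {is. length is = n \<and> sorted is \<and> set is \<subseteq> {1..}}. mset is = M}
      = (if size M = n \<and> 0 \<notin># M then {sorted_list_of_multiset M} else {})"
  proof -
    have "is = sorted_list_of_multiset M" if "sorted is" "mset is = M" for "is"
      using that by (metis sorted_list_of_multiset_mset sort_key_id_if_sorted sorted_sort_id)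
    moreover have "length (sorted_list_of_multiset M) = size M"
      by (metis mset_sorted_list_of_multiset size_mset)
    moreover have "x \<ge> Suc 0" if "0 \<notin># M" "x \<in># M" for x
      using that by (cases x) auto
    ultimately show ?thesis
      by (auto dest: multi_member_split)
  qed
  finally show ?thesis by simp
qed

text \<open>A positive power of a variable that divides \<open>M\<close> involves a variable of
  \<open>M\<close>, so at divisors of \<open>M\<close> the infinite power sum cannot be told from a
  finite one.\<close>

lemma agree_upto_psum:
  assumes "n > 0"
  shows "agree_upto M (psum n :: 'k::comm_ring_1 mseries) (\<Sum>i\<in>set_mset M - {0}. var i ^ n)"
  unfolding agree_upto_def
proof (intro allI impI)
  fix A assume A: "A \<subseteq># M"
  have "i \<in># M" if "replicate_mset n i = A" for i
    using that assms A by (metis in_replicate_mset mset_subset_eqD)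
  then have eq: "{i \<in> {1..}. replicate_mset n i = A}
      = (set_mset M - {0}) \<inter> {i. A = replicate_mset n i}"
    by (auto simp: Suc_le_eq)
  have "mcoeff (psum n :: 'k mseries) A
      = of_nat (card {i \<in> {1..}. replicate_mset n i = A})"
    unfolding psum_def by (rule mcoeff_formal_sum_monomial) (rule var_power)
  also have "\<dots> = (\<Sum>i\<in>set_mset M - {0}. if A = replicate_mset n i then 1 else 0)"
    unfolding eq by (simp add: sum.If_cases)
  also have "\<dots> = mcoeff (\<Sum>i\<in>set_mset M - {0}. var i ^ n) A"
    by (simp add: mcoeff_sum var_power mcoeff_monomial)
  finally show "mcoeff (psum n) A = mcoeff (\<Sum>i\<in>set_mset M - {0}. var i ^ n :: 'k mseries) A" .
qed

text \<open>The coefficient of \<open>M\<close> on the right counts the powers \<open>x\<^sub>i\<^sup>k\<close>, \<open>k > 0\<close>, that divide \<open>M\<close>.\<close>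

lemma newton: "of_nat n * h n = (\<Sum>k=1..n. psum k * h (n - k) :: 'k::comm_ring_1 mseries)"
proof (rule mseries_eqI)
  fix M :: "nat multiset"
  let ?K = "set_mset M - {0}"
  have "mcoeff (psum k * h (n - k)) M
      = (\<Sum>i\<in>?K. of_bool (k \<le> count M i \<and> size M = n \<and> 0 \<notin># M) :: 'k)" if "k \<in> {1..n}" for k
  proof -
    have "mcoeff (psum k * h (n - k)) M = mcoeff ((\<Sum>i\<in>?K. var i ^ k) * h (n - k) :: 'k mseries) M"
      using agree_upto_mult[OF agree_upto_psum[of k M], of "h (n - k)" "h (n - k)"] that
      by (auto simp: agree_upto_def)
    also have "\<dots> = (\<Sum>i\<in>?K. mcoeff (monomial (replicate_mset k i) * h (n - k)) M)"
      by (simp add: sum_distrib_right mcoeff_sum var_power)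
    also have "\<dots> = (\<Sum>i\<in>?K. of_bool (k \<le> count M i \<and> size M = n \<and> 0 \<notin># M))"
    proof (rule sum.cong[OF refl])
      fix i assume "i \<in> ?K"
      \<comment> \<open>As \<open>i\<close> is nonzero, removing copies of \<open>i\<close> leaves
        the occurrences of 0 unchanged.\<close>
      then have "0 \<in># M - replicate_mset k i \<longleftrightarrow> 0 \<in># M"
        by (auto simp: count_greater_zero_iff[symmetric] simp del: count_greater_zero_iff)
      moreover have "k \<le> count M i \<longleftrightarrow> replicate_mset k i \<subseteq># M"
        by (simp add: count_le_replicate_mset_subset_eq)
      moreover have "size (M - replicate_mset k i) = size M - k \<and> k \<le> size M"
        if "replicate_mset k i \<subseteq># M"
        using that size_Diff_submset[OF that] size_mset_mono[OF that] by simp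
      ultimately show "mcoeff (monomial (replicate_mset k i) * h (n - k)) M
          = (of_bool (k \<le> count M i \<and> size M = n \<and> 0 \<notin># M) :: 'k)"
        using that by (auto simp: mcoeff_monomial_mult mcoeff_h)
    qed
    finally show ?thesis .
  qed
  then have "mcoeff (\<Sum>k=1..n. psum k * h (n - k)) M
      = (\<Sum>k=1..n. \<Sum>i\<in>?K. of_bool (k \<le> count M i \<and> size M = n \<and> 0 \<notin># M) :: 'k)"
    by (simp add: mcoeff_sum)
  also have "\<dots> = (\<Sum>i\<in>?K. \<Sum>k=1..n. of_bool (k \<le> count M i \<and> size M = n \<and> 0 \<notin># M))"
    by (rule sum.swap)
  also have "\<dots> = of_nat n * mcoeff (h n) M"
  proof (cases "size M = n \<and> 0 \<notin># M")
    case True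
    \<comment> \<open>Since \<open>count M i\<close> is at most \<open>size M = n\<close>, the bound
      \<open>n\<close> on \<open>k\<close> cuts nothing off, and the inner sum is the full
      multiplicity of \<open>i\<close>.\<close>
    have "{1..n} \<inter> {k. k \<le> count M i} = {1..count M i}" for i
      using True count_le_size[of M i] by auto
    then have "(\<Sum>i\<in>?K. \<Sum>k=1..n. of_bool (k \<le> count M i \<and> size M = n \<and> 0 \<notin># M))
        = (\<Sum>i\<in>set_mset M. of_nat (count M i) :: 'k)"
      using True by (intro sum.cong) (auto simp: of_bool_def sum.If_cases)
    also have "\<dots> = of_nat (size M)"
      by (simp add: size_multiset_overloaded_eq)
    finally show ?thesis using True by (simp add: mcoeff_h)
  qed (auto simp: mcoeff_h)
  finally show "mcoeff (of_nat n * h n) M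
      = mcoeff (\<Sum>k=1..n. psum k * h (n - k) :: 'k mseries) M"
    by (simp add: mcoeff_of_nat_mult)
qed

section \<open>The forgetful morphism\<close>

lemma mcoeff_mscale: "mcoeff (mscale c f) M = c * mcoeff f M"
  by (simp add: mscale.rep_eq)

lemma mscale_0 [simp]: "mscale 0 f = 0" and mscale_1 [simp]: "mscale 1 f = f"
  by (rule mseries_eqI, simp add: mcoeff_mscale)+

lemma mscale_add: "mscale (c + d) f = mscale c f + mscale d f"
  by (rule mseries_eqI) (simp add: mcoeff_mscale mcoeff_add algebra_simps)

lemma mscale_mult: "mscale c f * mscale d g = mscale (c * d) (f * g)"
  by (rule mseries_eqI)
     (auto simp: mcoeff_mscale times_mseries.rep_eq sum_distrib_left algebra_simps
       intro!: sum.cong)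

lemma h_part_sort: "h_part (rev (sort p)) = (h_part p :: 'k::comm_ring_1 mseries)"
proof -
  have "h_part p = prod_mset (image_mset h (mset p) :: 'k mseries multiset)" for p
    by (simp add: h_part_def flip: mset_map prod_mset_prod_list)
  then show ?thesis by (metis mset_rev mset_sort)
qed

text \<open>Cancellation can shrink the support of a sum; a common larger index set makes the
  expansions of \<open>x\<close>, \<open>y\<close> and \<open>x + y\<close> comparable.\<close>

lemma chi_eq_sum:
  assumes "finite A" "Poly_Mapping.keys x \<subseteq> A"
  shows "chi x = (\<Sum>a\<in>A. mscale (Poly_Mapping.lookup x a) (h_part (parts a)))"
  unfolding chi_def h_part_sort
  by (rule sum.mono_neutral_left) (use assms in \<open>auto simp: in_keys_iff\<close>)

lemma chi_0 [simp]: "chi 0 = 0"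
  by (simp add: chi_def)

lemma chi_add: "chi (x + y) = chi x + chi y"
proof -
  let ?A = "Poly_Mapping.keys x \<union> Poly_Mapping.keys y"
  have "Poly_Mapping.keys (x + y) \<subseteq> ?A" by (rule Poly_Mapping.keys_add)
  then show ?thesis
    by (simp add: chi_eq_sum[of ?A] lookup_add mscale_add sum.distrib)
qed

lemma chi_sum: "chi (sum f I) = (\<Sum>i\<in>I. chi (f i))"
  by (induction I rule: infinite_finite_induct) (simp_all add: chi_add)

lemma chi_single: "chi (Poly_Mapping.single a c) = mscale c (h_part (parts a))"
  by (subst chi_eq_sum[of "{a}"]) auto

lemma sum_single_lookup:
  "(\<Sum>a\<in>Poly_Mapping.keys x. Poly_Mapping.single a (Poly_Mapping.lookup x a)) = x"
  by (rule poly_mapping_eqI)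
     (simp add: lookup_sum lookup_single when_def in_keys_iff)

text \<open>Bilinearity reduces this to \<open>single\<close> terms, where concatenating
  compositions multiplies the corresponding products of \<open>h\<close>.\<close>

lemma chi_mult: "chi (x * y :: 'k::field_char_0 nsym) = chi x * chi y"
proof -
  have single: "chi (Poly_Mapping.single a c * Poly_Mapping.single b d)
      = chi (Poly_Mapping.single a c) * chi (Poly_Mapping.single b d :: 'k nsym)"
    for a b c d
    by (simp add: Poly_Mapping.mult_single chi_single mscale_mult h_part_def
        plus_composition.rep_eq)
  show ?thesis
    by (subst (1 2) sum_single_lookup[symmetric], subst sum_single_lookup[symmetric, of x],
        subst sum_single_lookup[symmetric, of y])
       (simp only: sum_product chi_sum single)
qed

lemma chi_1 [simp]: "chi (1 :: 'k::field_char_0 nsym) = 1"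
proof -
  have "chi (1 :: 'k nsym) = chi (Poly_Mapping.single 0 1)" by simp
  then show ?thesis by (simp only: chi_single) (simp add: h_part_def zero_composition.rep_eq)
qed

text \<open>The signs in \<open>ribbon\<close>, \<open>Psi\<close> and \<open>chromatic_nsym\<close>
  are ring elements rather than scalars, so they pass through \<open>chi\<close> by
  multiplicativity.\<close>

lemma chi_minus_one_power: "chi ((- 1) ^ n :: 'k::field_char_0 nsym) = (- 1) ^ n"
proof -
  have "chi (- 1 :: 'k nsym) + 1 = 0"
    using chi_add[of "- 1 :: 'k nsym" 1] by simp
  then have "chi (- 1 :: 'k nsym) = - 1" by (simp add: eq_neg_iff_add_eq_0)
  then show ?thesis by (induction n) (simp_all only: power_0 power_Suc chi_1 chi_mult)
qed

lemma chi_prod_list: "chi (\<Prod>x\<leftarrow>xs. f x) = (\<Prod>x\<leftarrow>xs. chi (f x))"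
  by (induction xs) (simp_all add: chi_mult)


section \<open>The commutative image of \<open>\<Psi>\<^sub>n\<close>\<close>

definition compositions :: "nat \<Rightarrow> nat list set" where
  "compositions n = {c. 0 \<notin> set c \<and> sum_list c = n}"

lemma parts_in_compositions: "parts b \<in> compositions n \<longleftrightarrow> sum_list (parts b) = n"
  using parts[of b] by (simp add: compositions_def)

lemma compositions_0: "compositions 0 = {[]}"
  by (auto simp: compositions_def) (metis list.exhaust list.set_intros(1))

lemma compositions_rec:
  assumes "n > 0"
  shows "compositions n = (\<Union>m<n. (#) (n - m) ` compositions m)"
proof (intro equalityI subsetI)
  fix c assume "c \<in> compositions n"
  with assms obtain k c' where c: "c = k # c'" by (cases c) (auto simp: compositions_def)
  then have "sum_list c' < n" "k = n - sum_list c'" "c' \<in> compositions (sum_list c')"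
    using \<open>c \<in> compositions n\<close> by (auto simp: compositions_def)
  then show "c \<in> (\<Union>m<n. (#) (n - m) ` compositions m)" using c by blast
qed (auto simp: compositions_def)

lemma finite_compositions: "finite (compositions n)"
proof (induction n rule: less_induct)
  case (less n)
  then show ?case
    by (cases "n = 0") (auto simp: compositions_0 compositions_rec[of n])
qed

lemma sum_compositions_rec:
  assumes "n > 0"
  shows "(\<Sum>c\<in>compositions n. f c) = (\<Sum>m<n. \<Sum>c\<in>compositions m. f ((n - m) # c))"
proof -
  have "(\<Sum>c\<in>compositions n. f c) = (\<Sum>m<n. \<Sum>c\<in>(#) (n - m) ` compositions m. f c)"
    unfolding compositions_rec[OF assms]
    by (rule sum.UNION_disjoint) (use finite_compositions in \<open>auto simp: compositions_def\<close>)
  also have "\<dots> = (\<Sum>m<n. \<Sum>c\<in>compositions m. f ((n - m) # c))"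
    by (rule sum.cong[OF refl], subst sum.reindex) (auto simp: inj_on_def)
  finally show ?thesis .
qed

lemma h_0: "h 0 = 1"
  by (rule mseries_eqI) (auto simp: mcoeff_h one_mseries.rep_eq)

lemma psum_eq_sum_compositions:
  assumes "n > 0"
  shows "(\<Sum>c\<in>compositions n. (- 1) ^ (length c - 1) * of_nat (last c) * h_part c)
    = (psum n :: 'k::comm_ring_1 mseries)"
  using assms
proof (induction n rule: less_induct)
  case (less n)
  let ?f = "\<lambda>c. (- 1) ^ (length c - 1) * of_nat (last c) * h_part c :: 'k mseries"
  \<comment> \<open>The index 0 is set apart: it stands for the one-part composition
    \<open>[n]\<close>, which contributes \<open>of_nat n * h n\<close>. The induction hypothesis
    covers the positive indices.\<close>
  have eq: "{..<n} = insert 0 {1..<n}" using less.prems by auto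
  have "(\<Sum>c\<in>compositions m. ?f ((n - m) # c)) = - (psum m * h (n - m))" if "m \<in> {1..<n}" for m
  proof -
    \<comment> \<open>Here \<open>c\<close> is nonempty because \<open>m\<close> is positive, so a
      new first part keeps the last part and flips the sign.\<close>
    have "?f ((n - m) # c) = - h (n - m) * ?f c" if "c \<in> compositions m" for c
      using that \<open>m \<in> {1..<n}\<close>
      by (cases c) (auto simp: compositions_def h_part_def algebra_simps)
    then have "(\<Sum>c\<in>compositions m. ?f ((n - m) # c)) = - h (n - m) * (\<Sum>c\<in>compositions m. ?f c)"
      by (simp add: sum_distrib_left)
    also have "\<dots> = - (psum m * h (n - m))"
      using less.IH[of m] that by simp
    finally show ?thesis .
  qed
  then have "(\<Sum>c\<in>compositions n. ?f c)
      = of_nat n * h n + (\<Sum>m\<in>{1..<n}. - (psum m * h (n - m)))"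
    using less.prems
    by (simp add: sum_compositions_rec eq compositions_0 h_part_def)
  also have "of_nat n * h n = psum n + (\<Sum>m\<in>{1..<n}. psum m * h (n - m) :: 'k mseries)"
  proof -
    \<comment> \<open>In Newton's identity the summand for \<open>k = n\<close> is
      \<open>psum n * h 0\<close>, that is, \<open>psum n\<close>.\<close>
    have "{1..n} = insert n {1..<n}" using less.prems by auto
    then show ?thesis unfolding newton by (simp add: h_0)
  qed
  finally show ?case by (simp add: sum_negf)
qed

section \<open>Coarsenings of hook compositions\<close>

lemma length_le_sum_list: "0 \<notin> set c \<Longrightarrow> length c \<le> sum_list c" for c :: "nat list"
  by (induction c) auto

lemma sum_butlast_last: "c \<noteq> [] \<Longrightarrow> sum_list (butlast c) + last c = sum_list c"
  for c :: "nat list"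
  by (induction c) auto

text \<open>The largest descent, if there is one, is the sum of all parts but the last; with at most
  one part, both sides hold trivially.\<close>

lemma descents_subset_iff:
  "descents b \<subseteq> {1..i} \<longleftrightarrow> sum_list (butlast (parts b)) \<le> i"
proof
  assume *: "descents b \<subseteq> {1..i}"
  show "sum_list (butlast (parts b)) \<le> i"
  proof (cases "length (parts b) \<le> 1")
    case True
    then have "butlast (parts b) = []" by (cases "parts b") auto
    then show ?thesis by simp
  next
    case False
    then have "sum_list (butlast (parts b)) \<in> descents b"
      by (auto simp: descents_def butlast_conv_take intro!: exI[of _ "length (parts b) - 1"])
    with * show ?thesis by auto
  qed
next
  assume *: "sum_list (butlast (parts b)) \<le> i"
  show "descents b \<subseteq> {1..i}"
  proof
    fix d assume "d \<in> descents b"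
    then obtain k where k: "0 < k" "k < length (parts b)" "d = sum_list (take k (parts b))"
      by (auto simp: descents_def)
    then have "k \<le> length (parts b) - 1" by linarith
    then have "take k (parts b) = take k (butlast (parts b))"
      by (simp add: butlast_conv_take min_def)
    then have "d \<le> sum_list (butlast (parts b))"
      using k(3) append_take_drop_id[of k "butlast (parts b)"]
      by (metis le_add1 sum_list_append)
    \<comment> \<open>A sum of \<open>k\<close> positive parts is at least \<open>k\<close>, which
      gives the lower bound 1 for \<open>d\<close>.\<close>
    moreover have "0 \<notin> set (take k (parts b))"
      using parts[of b] by (auto dest: in_set_takeD)
    then have "length (take k (parts b)) \<le> d"
      using k(3) length_le_sum_list by blast
    ultimately show "d \<in> {1..i}" using k * by auto
  qed
qed

lemma parts_hook: "i < n \<Longrightarrow> parts (Composition (replicate i 1 @ [n - i])) = replicate i 1 @ [n - i]"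
  by (subst Composition_inverse) auto

lemma descents_hook:
  assumes "i < n"
  shows "descents (Composition (replicate i 1 @ [n - i])) = {1..i}"
proof -
  let ?c = "replicate i 1 @ [n - i]"
  have "descents (Composition ?c) = (\<lambda>k. sum_list (take k ?c)) ` {1..i}"
    unfolding descents_def parts_hook[OF assms] setcompr_eq_image by (rule image_cong) auto
  also have "\<dots> = (\<lambda>k. k) ` {1..i}"
    by (intro image_cong) (simp_all add: sum_list_replicate)
  finally show ?thesis by simp
qed

lemma coarser_hook:
  assumes "i < n"
  shows "coarser b (Composition (replicate i 1 @ [n - i]))
    \<longleftrightarrow> parts b \<in> compositions n \<and> sum_list (butlast (parts b)) \<le> i"
  unfolding coarser_def descents_hook[OF assms] descents_subset_iff parts_in_compositions
  using assms by (simp add: parts_hook sum_list_replicate del: One_nat_def)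

text \<open>The factor \<open>(- 1) ^ i\<close> cancels the dependence of the ribbon signs on the
  hook length \<open>i + 1\<close>. What remains depends on \<open>c\<close> alone, so that summing
  over \<open>i\<close> only counts hooks.\<close>

lemma chi_ribbon_hook:
  assumes "i < n"
  shows "chi ((- 1) ^ i * ribbon (Composition (replicate i 1 @ [n - i])) :: 'k::field_char_0 nsym)
    = (\<Sum>c | c \<in> compositions n \<and> sum_list (butlast c) \<le> i. (- 1) ^ (length c - 1) * h_part c)"
    (is "?l = sum ?f ?C")
proof -
  have "?l = (\<Sum>b | coarser b (Composition (replicate i 1 @ [n - i])).
      (- 1) ^ i * (- 1) ^ (Suc i - length (parts b)) * h_part (parts b))"
    using assms
    by (simp add: ribbon_def chi_mult chi_sum chi_minus_one_power chi_H_comp h_part_sort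
        parts_hook sum_distrib_left mult.assoc del: One_nat_def)
  also have "\<dots> = (\<Sum>c\<in>?C. ?f c)"
  proof (rule sum.reindex_bij_witness[where i = Composition and j = parts])
    fix b assume "b \<in> {b. coarser b (Composition (replicate i 1 @ [n - i]))}"
    then have b: "parts b \<in> compositions n" "sum_list (butlast (parts b)) \<le> i"
      using assms by (auto simp: coarser_hook simp del: One_nat_def)
    then show "parts b \<in> ?C" by simp
    have "parts b \<noteq> []" using b assms by (auto simp: compositions_def)
    moreover have "0 \<notin> set (butlast (parts b))"
      using parts[of b] by (auto dest: in_set_butlastD)
    then have "length (parts b) - 1 \<le> i"
      using b(2) length_le_sum_list[of "butlast (parts b)"] by simp
    \<comment> \<open>The length of \<open>parts b\<close> lies between 1 and \<open>i + 1\<close>,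
      so no subtraction truncates and the total exponent has the parity of
      \<open>length (parts b) - 1\<close>.\<close>
    ultimately have "i + (Suc i - length (parts b)) = 2 * (i + 1 - length (parts b)) + (length (parts b) - 1)"
      by (cases "parts b") auto
    then have "(- 1) ^ i * (- 1) ^ (Suc i - length (parts b))
        = ((- 1) ^ (length (parts b) - 1) :: 'k mseries)"
      by (simp only: power_add[symmetric]) (simp only: power_add power_mult, simp)
    then show "?f (parts b) = (- 1) ^ i * (- 1) ^ (Suc i - length (parts b)) * h_part (parts b)"
      by simp
  qed (use assms in \<open>auto simp: coarser_hook parts_inverse Composition_inverse compositions_def
        simp del: One_nat_def\<close>)
  finally show ?thesis .
qed

text \<open>A composition \<open>c\<close> of \<open>n\<close> is coarser than \<open>(1\<^sup>i, n - i)\<close> for exactly \<open>last c\<close> values of \<open>i\<close>.\<close>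

lemma chi_Psi:
  assumes "n > 0"
  shows "chi (Psi n :: 'k::field_char_0 nsym) = psum n"
proof -
  have "chi (Psi n :: 'k nsym)
      = (\<Sum>i<n. \<Sum>c\<in>compositions n. if sum_list (butlast c) \<le> i
          then (- 1) ^ (length c - 1) * h_part c else 0)"
    by (simp add: Psi_def chi_sum chi_ribbon_hook finite_compositions
        sum.inter_filter[symmetric] del: One_nat_def)
  also have "\<dots> = (\<Sum>c\<in>compositions n. \<Sum>i<n. if sum_list (butlast c) \<le> i
          then (- 1) ^ (length c - 1) * h_part c else 0)"
    by (rule sum.swap)
  also have "\<dots> = (\<Sum>c\<in>compositions n. (- 1) ^ (length c - 1) * of_nat (last c) * h_part c)"
  proof (rule sum.cong[OF refl])
    fix c assume c: "c \<in> compositions n"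
    then have "sum_list (butlast c) + last c = n"
      using assms by (subst sum_butlast_last) (auto simp: compositions_def)
    then have "{i. i < n \<and> sum_list (butlast c) \<le> i} = {sum_list (butlast c)..<n}"
      and "n - sum_list (butlast c) = last c"
      by auto
    then show "(\<Sum>i<n. if sum_list (butlast c) \<le> i then (- 1) ^ (length c - 1) * h_part c else 0)
        = ((- 1) ^ (length c - 1) * of_nat (last c) * h_part c :: 'k mseries)"
      by (simp flip: sum.inter_filter)
  qed
  finally show ?thesis by (simp only: psum_eq_sum_compositions[OF assms])
qed

section \<open>Ordering the components\<close>

text \<open>A new element goes between those that precede it and the rest: totality puts the rest
  after it, and transitivity orders the two halves.\<close>

lemma ex_sorted_wrt_list_of_set:
  assumes "finite A" "transp R" "totalp_on A R"
  shows "\<exists>xs. distinct xs \<and> set xs = A \<and> sorted_wrt R xs"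
  using assms(1,3)
proof (induction A)
  case (insert x A)
  have "totalp_on A R" using insert.prems by (rule totalp_on_subset) auto
  then obtain xs where xs: "distinct xs" "set xs = A" "sorted_wrt R xs"
    using insert.IH by blast
  have split: "R x y" if "y \<in> A" "\<not> R y x" for y
    using totalp_onD[OF insert.prems, of x y] insert.hyps(2) that by auto
  let ?ys = "filter (\<lambda>y. R y x) xs @ x # filter (\<lambda>y. \<not> R y x) xs"
  have "R y z" if "y \<in> A" "z \<in> A" "R y x" "\<not> R z x" for y z
    using transpD[OF assms(2), of y x z] split[of z] that by simp
  then have "sorted_wrt R ?ys"
    using xs split by (simp add: sorted_wrt_append sorted_wrt_filter)
  moreover have "distinct ?ys" "set ?ys = insert x A"
    using xs insert.hyps by auto
  ultimately show ?case by blast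
qed simp

text \<open>Two different heads would each precede the other, against asymmetry.\<close>

lemma sorted_wrt_list_unique:
  assumes "sorted_wrt R xs" "sorted_wrt R ys" "distinct xs" "distinct ys" "set xs = set ys"
    and asym: "\<And>x y. R x y \<Longrightarrow> R y x \<Longrightarrow> False"
  shows "xs = ys"
  using assms(1-5)
proof (induction xs arbitrary: ys)
  case (Cons x xs)
  then obtain y ys' where ys: "ys = y # ys'" by (cases ys) auto
  have "x = y"
  proof (rule ccontr)
    assume "x \<noteq> y"
    with Cons.prems ys have "R x y" "R y x" by auto
    then show False by (rule asym)
  qed
  moreover have "xs = ys'"
    using Cons.prems ys \<open>x = y\<close> by (intro Cons.IH) auto
  ultimately show ?case using ys by simp
qed simp

lemma comp_greater_asym: "comp_greater lab D C C' \<Longrightarrow> comp_greater lab D C' C \<Longrightarrow> False"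
  using lexord_asymmetric[of "{(i, j). i < (j :: nat)}"]
  by (auto simp: comp_greater_def asym_on_def)

lemma comp_greater_trans:
  "comp_greater lab D A B \<Longrightarrow> comp_greater lab D B C \<Longrightarrow> comp_greater lab D A C"
  by (auto simp: comp_greater_def trans_def elim: lexord_trans)

text \<open>Injectivity of \<open>lab\<close> gives distinct sets distinct words, and
  \<open>lexord\<close> over a linear order is linear, so the third clause breaks every remaining
  tie.\<close>

lemma comp_greater_total:
  assumes "finite V" "inj_on lab V" "C \<subseteq> V" "C' \<subseteq> V" "C \<noteq> C'"
  shows "comp_greater lab D C C' \<or> comp_greater lab D C' C"
proof -
  have "finite (lab ` C)" "finite (lab ` C')"
    using assms by (meson finite_imageI finite_subset)+
  moreover have "lab ` C \<noteq> lab ` C'"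
    using assms by (metis inj_on_image_eq_iff)
  ultimately have "index_word lab C \<noteq> index_word lab C'"
    unfolding index_word_def by (metis set_sorted_list_of_set)
  then have "(index_word lab C, index_word lab C') \<in> lexord {(i, j). i < j}
      \<or> (index_word lab C', index_word lab C) \<in> lexord {(i, j). i < j}"
    using lexord_linear[of "{(i, j). i < (j :: nat)}" "index_word lab C" "index_word lab C'"]
    by (auto simp: less_linear)
  then show ?thesis by (auto simp: comp_greater_def)
qed

text \<open>Existence and uniqueness resolve the \<open>THE\<close>. The order itself is then
  forgotten, since the commutative image does not see it.\<close>

lemma sorted_components:
  assumes "finite V" "V = pverts D" "inj_on lab V"
  shows "distinct (sorted_components lab D S)"
    and "set (sorted_components lab D S) = components V (undirected S)"
proof -
  let ?K = "components V (undirected S)"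
  let ?P = "\<lambda>Cs. distinct Cs \<and> set Cs = ?K \<and> sorted_wrt (comp_greater lab D) Cs"
  have sub: "C \<subseteq> V" if "C \<in> ?K" for C
    using that by (auto simp: components_def quotient_def)
  then have "finite ?K"
    using assms(1) by (meson Pow_iff finite_Pow_iff finite_subset subsetI)
  then have "\<exists>Cs. ?P Cs"
  proof (rule ex_sorted_wrt_list_of_set)
    show "transp (comp_greater lab D)"
      by (rule transpI) (rule comp_greater_trans)
    show "totalp_on ?K (comp_greater lab D)"
      using comp_greater_total[OF assms(1,3)] sub by (intro totalp_onI) blast
  qed
  then have "\<exists>!Cs. ?P Cs"
    by (metis sorted_wrt_list_unique comp_greater_asym)
  then have "?P (sorted_components lab D S)"
    unfolding sorted_components_def assms(2) by (rule theI')
  then show "distinct (sorted_components lab D S)"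
    and "set (sorted_components lab D S) = ?K" by auto
qed

section \<open>Colorings constant on the components\<close>

lemma equiv_components:
  "equiv V {(u, v). u \<in> V \<and> v \<in> V \<and> (u, v) \<in> {(a, b). {a, b} \<in> F}\<^sup>*}"
proof -
  have "sym {(a, b). {a, b} \<in> F}" by (auto simp: sym_def insert_commute)
  then have "sym ({(a, b). {a, b} \<in> F}\<^sup>*)" by (rule sym_rtrancl)
  then show ?thesis
    by (auto simp: equiv_def refl_on_def sym_def trans_def intro: rtrancl_trans)
qed

text \<open>Expanding the product picks one element of \<open>K\<close> for each class. Such choices
  correspond to the functions on \<open>V\<close> constant on classes: compose with the class map in
  one direction, evaluate at any representative in the other.\<close>

lemma prod_quotient_sum_power:
  fixes x :: "'b \<Rightarrow> 'c::comm_ring_1"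
  assumes "equiv V r" "finite V" "finite K"
  shows "(\<Prod>C\<in>V // r. \<Sum>i\<in>K. x i ^ card C)
    = (\<Sum>\<kappa> | \<kappa> \<in> V \<rightarrow>\<^sub>E K \<and> (\<forall>(u, v)\<in>r. \<kappa> u = \<kappa> v). \<Prod>v\<in>V. x (\<kappa> v))"
proof -
  have fin: "finite C" if "C \<in> V // r" for C
    using that assms finite_equiv_class equiv_type by metis
  have block: "v \<in> V \<and> r `` {v} = C" if C: "C \<in> V // r" and v: "v \<in> C" for C v
  proof -
    obtain w where "w \<in> V" "C = r `` {w}" using C by (rule quotientE)
    then show ?thesis
      using v equiv_class_eq[OF assms(1), of w v] equiv_type[OF assms(1)] by auto
  qed
  have rep: "(SOME v. v \<in> C) \<in> C" if "C \<in> V // r" for C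
    using in_quotient_imp_non_empty[OF assms(1) that] by (simp add: some_in_eq)
  have "(\<Prod>C\<in>V // r. \<Sum>i\<in>K. x i ^ card C)
      = (\<Sum>g\<in>V // r \<rightarrow>\<^sub>E K. \<Prod>C\<in>V // r. x (g C) ^ card C)"
    using assms(3) finite_quotient[OF assms(2) equiv_type[OF assms(1)]]
    by (subst prod_sum_PiE) auto
  also have "\<dots> = (\<Sum>\<kappa> | \<kappa> \<in> V \<rightarrow>\<^sub>E K \<and> (\<forall>(u, v)\<in>r. \<kappa> u = \<kappa> v). \<Prod>v\<in>V. x (\<kappa> v))"
  proof (rule sum.reindex_bij_witness[where
        j = "\<lambda>g. \<lambda>v\<in>V. g (r `` {v})" and i = "\<lambda>\<kappa>. \<lambda>C\<in>V // r. \<kappa> (SOME v. v \<in> C)"])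
    fix g assume g: "g \<in> V // r \<rightarrow>\<^sub>E K"
    show "(\<lambda>C\<in>V // r. (\<lambda>v\<in>V. g (r `` {v})) (SOME v. v \<in> C)) = g"
      using g block[OF _ rep] by (auto simp: fun_eq_iff PiE_def extensional_def restrict_def)
    have "r `` {u} = r `` {v} \<and> u \<in> V \<and> v \<in> V" if "(u, v) \<in> r" for u v
      using equiv_class_eq[OF assms(1) that] equiv_type[OF assms(1)] that by auto
    then show "(\<lambda>v\<in>V. g (r `` {v}))
        \<in> {\<kappa>. \<kappa> \<in> V \<rightarrow>\<^sub>E K \<and> (\<forall>(u, v)\<in>r. \<kappa> u = \<kappa> v)}"
      using g by (fastforce simp: quotientI)
    have "(\<Prod>v\<in>V. x ((\<lambda>v\<in>V. g (r `` {v})) v)) = (\<Prod>v\<in>\<Union>(V // r). x (g (r `` {v})))"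
      using assms(1) by (simp add: Union_quotient)
    also have "\<dots> = (\<Prod>C\<in>V // r. \<Prod>v\<in>C. x (g (r `` {v})))"
      using fin assms(1) by (subst prod.Union_disjoint) (auto dest: quotient_disj)
    also have "\<dots> = (\<Prod>C\<in>V // r. x (g C) ^ card C)"
    proof (rule prod.cong[OF refl])
      fix C assume C: "C \<in> V // r"
      show "(\<Prod>v\<in>C. x (g (r `` {v}))) = x (g C) ^ card C"
        using block[OF C] by simp
    qed
    finally show "(\<Prod>v\<in>V. x ((\<lambda>v\<in>V. g (r `` {v})) v)) = (\<Prod>C\<in>V // r. x (g C) ^ card C)" .
  next
    fix \<kappa> assume "\<kappa> \<in> {\<kappa>. \<kappa> \<in> V \<rightarrow>\<^sub>E K \<and> (\<forall>(u, v)\<in>r. \<kappa> u = \<kappa> v)}"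
    then have \<kappa>: "\<kappa> \<in> V \<rightarrow>\<^sub>E K" "\<And>u v. (u, v) \<in> r \<Longrightarrow> \<kappa> u = \<kappa> v" by auto
    have "\<kappa> (SOME u. u \<in> r `` {v}) = \<kappa> v" if "v \<in> V" for v
      using \<kappa>(2) rep[OF quotientI[OF that]] by (metis Image_singleton_iff)
    then show "(\<lambda>v\<in>V. (\<lambda>C\<in>V // r. \<kappa> (SOME v. v \<in> C)) (r `` {v})) = \<kappa>"
      using \<kappa>(1) by (auto simp: fun_eq_iff quotientI PiE_def extensional_def)
    show "(\<lambda>C\<in>V // r. \<kappa> (SOME v. v \<in> C)) \<in> V // r \<rightarrow>\<^sub>E K"
      using PiE_mem[OF \<kappa>(1)] block[OF _ rep] by simp
  qed
  finally show ?thesis .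
qed

text \<open>Equality of colors spreads from single arcs along undirected paths.\<close>

lemma constant_on_components_iff:
  assumes "S \<subseteq> V \<times> V"
  shows "(\<forall>(u, v)\<in>{(u, v). u \<in> V \<and> v \<in> V \<and> (u, v) \<in> {(a, b). {a, b} \<in> undirected S}\<^sup>*}. \<kappa> u = \<kappa> v)
    \<longleftrightarrow> (\<forall>(u, v)\<in>S. \<kappa> u = \<kappa> v)" (is "?l \<longleftrightarrow> ?r")
proof
  assume ?l
  show ?r
  proof clarify
    fix u v assume uv: "(u, v) \<in> S"
    then have "(u, v) \<in> {(a, b). {a, b} \<in> undirected S}\<^sup>*" by (auto simp: undirected_def)
    with uv assms \<open>?l\<close> show "\<kappa> u = \<kappa> v" by auto
  qed
next
  assume ?r
  have "\<kappa> u = \<kappa> v" if "(u, v) \<in> {(a, b). {a, b} \<in> undirected S}\<^sup>*" for u v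
    using that
  proof induction
    case (step y z)
    then have "\<kappa> y = \<kappa> z"
      using \<open>?r\<close> by (auto simp: undirected_def doubleton_eq_iff)
    with step show ?case by simp
  qed simp
  then show ?l by auto
qed

lemma prod_components_sum_power:
  fixes x :: "'b \<Rightarrow> 'c::comm_ring_1"
  assumes "finite V" "finite K" "S \<subseteq> V \<times> V"
  shows "(\<Prod>C\<in>components V (undirected S). \<Sum>i\<in>K. x i ^ card C)
    = (\<Sum>\<kappa> | \<kappa> \<in> V \<rightarrow>\<^sub>E K \<and> (\<forall>(u, v)\<in>S. \<kappa> u = \<kappa> v). \<Prod>v\<in>V. x (\<kappa> v))"
  unfolding components_def
  by (subst prod_quotient_sum_power[OF equiv_components assms(1,2)])
     (simp only: constant_on_components_iff[OF assms(3)])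

lemma sum_minus_one_power_constant:
  assumes "finite E"
  shows "(\<Sum>S\<in>Pow E. (- 1) ^ card S * of_bool (\<forall>(u, v)\<in>S. \<kappa> u = \<kappa> v))
    = (of_bool (\<forall>(u, v)\<in>E. \<kappa> u \<noteq> \<kappa> v) :: 'c::comm_ring_1)"
proof -
  have prod: "(\<Prod>e\<in>S. of_bool (P e)) = (of_bool (\<forall>e\<in>S. P e) :: 'c)" if "finite S" for S P
    using that by (induction S) auto
  \<comment> \<open>The trivial product over \<open>E - S\<close> gives the sum the shape of the
    subset expansion of a product of differences.\<close>
  have "(\<Sum>S\<in>Pow E. (- 1) ^ card S * of_bool (\<forall>(u, v)\<in>S. \<kappa> u = \<kappa> v))
      = (\<Sum>S\<in>Pow E. (- 1) ^ card S * (\<Prod>(u, v)\<in>S. of_bool (\<kappa> u = \<kappa> v)) * (\<Prod>e\<in>E - S. 1) :: 'c)"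
    using assms by (intro sum.cong) (auto simp: prod case_prod_unfold finite_subset)
  also have "\<dots> = (\<Prod>e\<in>E. 1 - (case e of (u, v) \<Rightarrow> of_bool (\<kappa> u = \<kappa> v)))"
    using assms by (rule prod_diff_conv_sum[symmetric])
  also have "\<dots> = (\<Prod>e\<in>E. of_bool (\<kappa> (fst e) \<noteq> \<kappa> (snd e)))"
    by (intro prod.cong) auto
  finally show ?thesis using assms by (simp add: prod case_prod_unfold)
qed

section \<open>The chromatic symmetric function\<close>

lemma components_nonempty_finite:
  assumes "finite V" "C \<in> components V F"
  shows "finite C" "C \<noteq> {}"
  using assms(1) in_quotient_imp_subset[OF equiv_components assms(2)[unfolded components_def]]
    in_quotient_imp_non_empty[OF equiv_components assms(2)[unfolded components_def]]
  by (auto intro: finite_subset)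

text \<open>Components are nonempty, so the list of sizes is a genuine composition and
  \<open>chi_Psi\<close> applies to each part; distinctness turns the list product into a set
  product.\<close>

lemma chi_Psi_comp_alpha:
  assumes "finite (pverts D)" "inj_on lab (pverts D)"
  shows "chi (Psi_comp (alpha lab D S) :: 'k::field_char_0 nsym)
    = (\<Prod>C\<in>components (pverts D) (undirected S). psum (card C))"
proof -
  let ?Cs = "sorted_components lab D S"
  note Cs = sorted_components[OF assms(1) refl assms(2), of S]
  have pos: "card C > 0" if "C \<in> set ?Cs" for C
    using that Cs(2) components_nonempty_finite[OF assms(1)] by (simp add: card_gt_0_iff)
  then have "parts (alpha lab D S) = map card ?Cs"
    unfolding alpha_def by (subst Composition_inverse) force+
  then have "chi (Psi_comp (alpha lab D S) :: 'k nsym) = (\<Prod>C\<leftarrow>?Cs. chi (Psi (card C)))"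
    by (simp add: Psi_comp_def chi_prod_list o_def)
  also have "\<dots> = (\<Prod>C\<leftarrow>?Cs. psum (card C))"
    using pos by (simp add: chi_Psi cong: map_cong)
  finally show ?thesis
    using Cs by (simp flip: prod.distinct_set_conv_list)
qed

text \<open>A coloring with monomial \<open>M\<close> uses only colors occurring in
  \<open>M\<close>, so a finite set of colors suffices for this coefficient.\<close>

lemma mcoeff_chromatic_sym:
  assumes "finite V"
  shows "mcoeff (chromatic_sym V F :: 'k::comm_ring_1 mseries) M
    = mcoeff (\<Sum>\<kappa> | \<kappa> \<in> V \<rightarrow>\<^sub>E (set_mset M - {0}) \<and> (\<forall>u v. {u, v} \<in> F \<longrightarrow> \<kappa> u \<noteq> \<kappa> v).
        \<Prod>v\<in>V. var (\<kappa> v)) M" (is "_ = mcoeff (sum _ ?A) M")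
proof -
  let ?m = "\<lambda>\<kappa>. image_mset \<kappa> (mset_set V)"
  have "finite ?A"
    using assms by (intro finite_subset[OF _ finite_PiE[of V "\<lambda>_. set_mset M - {0}"]]) auto
  have "\<kappa> \<in> V \<rightarrow>\<^sub>E {1..} \<longleftrightarrow> \<kappa> \<in> V \<rightarrow>\<^sub>E (set_mset M - {0})" if "M = ?m \<kappa>" for \<kappa>
    using assms that by (auto simp: PiE_iff Suc_le_eq)
  then have eq: "{\<kappa> \<in> proper_colorings V F. ?m \<kappa> = M} = ?A \<inter> {\<kappa>. M = ?m \<kappa>}"
    unfolding proper_colorings_def by blast
  have "mcoeff (chromatic_sym V F :: 'k mseries) M
      = of_nat (card {\<kappa> \<in> proper_colorings V F. ?m \<kappa> = M})"
    unfolding chromatic_sym_def by (rule mcoeff_formal_sum_monomial) (rule prod_var[OF assms])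
  also have "\<dots> = (\<Sum>\<kappa>\<in>?A. if M = ?m \<kappa> then 1 else 0)"
    unfolding eq using \<open>finite ?A\<close> by (simp add: sum.If_cases)
  finally show ?thesis
    by (simp add: mcoeff_sum prod_var[OF assms] mcoeff_monomial)
qed

theorem theorem2:
  fixes D :: "'a pair_pre_digraph" and lab :: "'a \<Rightarrow> nat"
  assumes "pair_digraph D"
    and "bij_betw lab (pverts D) {1..card (pverts D)}"
  shows "chi (chromatic_nsym lab D :: 'k::field_char_0 nsym)
       = chromatic_sym (pverts D) (undirected (parcs D))"
proof (rule mseries_eqI)
  fix M :: "nat multiset"
  let ?V = "pverts D" and ?E = "parcs D" and ?K = "set_mset M - {0}"
  let ?w = "\<lambda>\<kappa>. \<Prod>v\<in>?V. var (\<kappa> v) :: 'k mseries"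
  interpret pair_digraph D by fact
  have fin: "finite ?V" "finite ?E" "finite (?V \<rightarrow>\<^sub>E ?K)"
    using pair_finite_verts pair_finite_arcs by (auto intro: finite_PiE)
  have "?E \<subseteq> ?V \<times> ?V"
    using arc_fst_in_verts arc_snd_in_verts by force
  have "inj_on lab ?V"
    using assms(2) by (rule bij_betw_imp_inj_on)
  have coeff: "mcoeff (\<Prod>C\<in>components ?V (undirected S). psum (card C) :: 'k mseries) M
      = mcoeff (\<Sum>\<kappa>\<in>?V \<rightarrow>\<^sub>E ?K. of_bool (\<forall>(u, v)\<in>S. \<kappa> u = \<kappa> v) * ?w \<kappa>) M"
    if "S \<subseteq> ?E" for S
  proof -
    have "agree_upto M (\<Prod>C\<in>components ?V (undirected S). psum (card C) :: 'k mseries)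
        (\<Prod>C\<in>components ?V (undirected S). \<Sum>i\<in>?K. var i ^ card C)"
      using components_nonempty_finite[OF fin(1)]
      by (intro agree_upto_prod agree_upto_psum) (auto simp: card_gt_0_iff)
    also have "(\<Prod>C\<in>components ?V (undirected S). \<Sum>i\<in>?K. var i ^ card C)
        = (\<Sum>\<kappa> | \<kappa> \<in> ?V \<rightarrow>\<^sub>E ?K \<and> (\<forall>(u, v)\<in>S. \<kappa> u = \<kappa> v). ?w \<kappa>)"
      using fin(1) that \<open>?E \<subseteq> ?V \<times> ?V\<close> by (intro prod_components_sum_power) auto
    \<comment> \<open>Moving the condition into a weight makes the range of the sum independent of
      \<open>S\<close>, as the later exchange of sums requires.\<close>
    also have "\<dots> = (\<Sum>\<kappa>\<in>?V \<rightarrow>\<^sub>E ?K. of_bool (\<forall>(u, v)\<in>S. \<kappa> u = \<kappa> v) * ?w \<kappa>)"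
      using fin(3) by (intro sum.mono_neutral_cong_left) auto
    finally show ?thesis by (simp add: agree_upto_def)
  qed
  have "mcoeff (chi (chromatic_nsym lab D :: 'k nsym)) M
      = (\<Sum>S\<in>Pow ?E. (- 1) ^ card S
          * mcoeff (\<Prod>C\<in>components ?V (undirected S). psum (card C)) M)"
    by (simp add: chromatic_nsym_def chi_sum chi_mult chi_minus_one_power
        chi_Psi_comp_alpha[OF fin(1) \<open>inj_on lab ?V\<close>] mcoeff_sum mcoeff_minus_one_power_mult)
  also have "\<dots> = mcoeff (\<Sum>S\<in>Pow ?E. \<Sum>\<kappa>\<in>?V \<rightarrow>\<^sub>E ?K.
      (- 1) ^ card S * of_bool (\<forall>(u, v)\<in>S. \<kappa> u = \<kappa> v) * ?w \<kappa>) M"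
    by (simp add: coeff mcoeff_sum[of _ "Pow ?E"] mult.assoc
        mcoeff_minus_one_power_mult flip: sum_distrib_left)
  also have "(\<Sum>S\<in>Pow ?E. \<Sum>\<kappa>\<in>?V \<rightarrow>\<^sub>E ?K.
      (- 1) ^ card S * of_bool (\<forall>(u, v)\<in>S. \<kappa> u = \<kappa> v) * ?w \<kappa>)
      = (\<Sum>\<kappa>\<in>?V \<rightarrow>\<^sub>E ?K. of_bool (\<forall>(u, v)\<in>?E. \<kappa> u \<noteq> \<kappa> v) * ?w \<kappa>)"
    by (subst sum.swap)
       (simp only: sum_minus_one_power_constant[OF fin(2)] flip: sum_distrib_right)
  also have "\<dots> = (\<Sum>\<kappa> | \<kappa> \<in> ?V \<rightarrow>\<^sub>E ?K \<and> (\<forall>(u, v)\<in>?E. \<kappa> u \<noteq> \<kappa> v). ?w \<kappa>)"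
    using fin(3) by (intro sum.mono_neutral_cong_right) auto
  \<comment> \<open>An arc and its reverse give the same edge and the same symmetric condition on
    colors.\<close>
  also have "{\<kappa>. \<kappa> \<in> ?V \<rightarrow>\<^sub>E ?K \<and> (\<forall>(u, v)\<in>?E. \<kappa> u \<noteq> \<kappa> v)}
      = {\<kappa>. \<kappa> \<in> ?V \<rightarrow>\<^sub>E ?K \<and> (\<forall>u v. {u, v} \<in> undirected ?E \<longrightarrow> \<kappa> u \<noteq> \<kappa> v)}"
    by (fastforce simp: undirected_def doubleton_eq_iff)
  finally show "mcoeff (chi (chromatic_nsym lab D :: 'k nsym)) M
      = mcoeff (chromatic_sym ?V (undirected ?E)) M"
    by (simp only: mcoeff_chromatic_sym[OF fin(1)])
qed

end
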